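(* Consider the scheduling problem HYP-SOC (defined in the context), with hydrogen price $\chi>0$, and let $(f_t,p_t,h_t,\widetilde p_t,z^{\mathrm{on}}_t,z^{\mathrm{off}}_t,z^{\mathrm{sb}}_t,z^{\mathrm{su}}_t)_{t\in\mathcal T}$ be an optimal solution of it. If the maximum total hydrogen production constraint is nonbinding at this optimum, i.e. $\sum_{t\in\mathcal H_n}h_t<D^{\max}_n$ for all $n\in\mathcal N$, then the relaxation is exact, i.e. $$h_t=A\widetilde p_t^{\,2}+B\widetilde p_t+C z^{\mathrm{on}}_t\qquad\text{for all } t\in\mathcal T .$$
   Context: Let $\mathcal T=\{1,\dots,T\}$ be a finite set of time steps, partitioned into sub-periods $\mathcal H_n\subseteq\mathcal T$, $n\in\mathcal N$. The following real parameters are given: power prices $\lambda_t$ (of any sign), a hydrogen price $\chi>0$, wind power production forecasts $W_t$, maximum hydrogen demands $D^{\max}_n$, a startup cost $K^{\mathrm{su}}$, the minimum, maximum and standby power consumption $P^{\min},P^{\max},P^{\mathrm{sb}}$ of the electrolyzer, and coefficients $A<0$, $B>0$, $C<0$. The problem HYP-SOC is to maximize $$\sum_{t\in\mathcal T}\left(f_t\lambda_t+h_t\chi-z^{\mathrm{su}}_tK^{\mathrm{su}}\right)$$ over real variables $f_t,p_t,h_t,\widetilde p_t\ge 0$ and binary variables $z^{\mathrm{on}}_t,z^{\mathrm{off}}_t,z^{\mathrm{sb}}_t,z^{\mathrm{su}}_t\in\{0,1\}$ ($t\in\mathcal T$) subject to: - $W_t-f_t-p_t=0$ for all $t\in\mathcal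 T$ (power balance); - $\sum_{t\in\mathcal H_n}h_t\le D^{\max}_n$ for all $n\in\mathcal N$ (maximum total hydrogen production constraint); - $z^{\mathrm{on}}_t+z^{\mathrm{off}}_t+z^{\mathrm{sb}}_t=1$ for all $t\in\mathcal T$; - $P^{\min}z^{\mathrm{on}}_t+P^{\mathrm{sb}}z^{\mathrm{sb}}_t\le p_t\le P^{\max}z^{\mathrm{on}}_t+P^{\mathrm{sb}}z^{\mathrm{sb}}_t$ for all $t\in\mathcal T$; - $z^{\mathrm{su}}_t\ge z^{\mathrm{off}}_{t-1}+z^{\mathrm{on}}_t+z^{\mathrm{sb}}_t-1$ for all $t\in\mathcal T\setminus\{1\}$, and $z^{\mathrm{su}}_1=0$; - $h_t\le A\widetilde p_t^{\,2}+B\widetilde p_t+Cz^{\mathrm{on}}_t$ for all $t\in\mathcal T$ (the relaxation constraint); - $P^{\min}z^{\mathrm{on}}_t\le\widetilde p_t\le P^{\max}z^{\mathrm{on}}_t$ for all $t\in\mathcal T$; - $p_t=\widetilde p_t+P^{\mathrm{sb}}z^{\mathrm{sb}}_t$ for all $t\in\mathcal T$. It is assumed that an optimal solution exists. The relaxation is called exact (at an optimal solution) if the relaxation constraint holds with equality there, for every time step; it is inexact at a time step $t$ if the relaxation constraint is strict at $t$. *)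

theory Defs
  imports Complex_Main "HOL-Library.Disjoint_Sets"
begin

text \<open>
  Data of the scheduling problem. The time steps are \<open>1, \<dots>, horizon\<close>; the sub-periods
  \<open>sub_period n\<close> are indexed by \<open>n \<in> period_index\<close>. Time-indexed and period-indexed
  parameters are total functions of which only the values on these index sets matter.
  When the electrolyzer is on, the hydrogen production curve is the concave quadratic
  \<open>coeff_A * x\<^sup>2 + coeff_B * x + coeff_C\<close>.
\<close>

record 'n hyp_soc_data =
  horizon :: nat
  period_index :: "'n set"
  sub_period :: "'n \<Rightarrow> nat set"
  power_price :: "nat \<Rightarrow> real"
  hydrogen_price :: real
  wind :: "nat \<Rightarrow> real"
  demand_max :: "'n \<Rightarrow> real"
  startup_cost :: real
  P_min :: real
  P_max :: real
  P_sb :: real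
  coeff_A :: real
  coeff_B :: real
  coeff_C :: real

abbreviation time_steps :: "'n hyp_soc_data \<Rightarrow> nat set" where
  "time_steps d \<equiv> {1..horizon d}"

definition valid_data :: "'n hyp_soc_data \<Rightarrow> bool" where
  "valid_data d \<longleftrightarrow>
     1 \<le> horizon d \<and>
     disjoint_family_on (sub_period d) (period_index d) \<and>
     (\<Union>n\<in>period_index d. sub_period d n) = time_steps d \<and>
     (\<forall>n\<in>period_index d. sub_period d n \<noteq> {}) \<and>
     hydrogen_price d > 0 \<and>
     coeff_A d < 0 \<and> coeff_B d > 0 \<and> coeff_C d < 0"

text \<open>
  Decision variables: \<open>sold\<close> is $f$, \<open>power\<close> is $p$, \<open>hydrogen\<close> is $h$ and
  \<open>power_on\<close> is $\widetilde p$; the binary variables are real numbers constrained to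
  \<open>{0, 1}\<close>.
\<close>

record schedule =
  sold :: "nat \<Rightarrow> real"
  power :: "nat \<Rightarrow> real"
  hydrogen :: "nat \<Rightarrow> real"
  power_on :: "nat \<Rightarrow> real"
  z_on :: "nat \<Rightarrow> real"
  z_off :: "nat \<Rightarrow> real"
  z_sb :: "nat \<Rightarrow> real"
  z_su :: "nat \<Rightarrow> real"

definition production_bound :: "'n hyp_soc_data \<Rightarrow> schedule \<Rightarrow> nat \<Rightarrow> real" where
  "production_bound d s t =
     coeff_A d * (power_on s t)\<^sup>2 + coeff_B d * power_on s t + coeff_C d * z_on s t"

definition feasible :: "'n hyp_soc_data \<Rightarrow> schedule \<Rightarrow> bool" where
  "feasible d s \<longleftrightarrow>
     (\<forall>t\<in>time_steps d.
        sold s t \<ge> 0 \<and> power s t \<ge> 0 \<and> hydrogen s t \<ge> 0 \<and> power_on s t \<ge> 0 \<and>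
        z_on s t \<in> {0, 1} \<and> z_off s t \<in> {0, 1} \<and> z_sb s t \<in> {0, 1} \<and> z_su s t \<in> {0, 1}) \<and>
     (\<forall>t\<in>time_steps d. wind d t - sold s t - power s t = 0) \<and>
     (\<forall>n\<in>period_index d. (\<Sum>t\<in>sub_period d n. hydrogen s t) \<le> demand_max d n) \<and>
     (\<forall>t\<in>time_steps d. z_on s t + z_off s t + z_sb s t = 1) \<and>
     (\<forall>t\<in>time_steps d.
        P_min d * z_on s t + P_sb d * z_sb s t \<le> power s t \<and>
        power s t \<le> P_max d * z_on s t + P_sb d * z_sb s t) \<and>
     (\<forall>t\<in>time_steps d - {1}. z_su s t \<ge> z_off s (t - 1) + z_on s t + z_sb s t - 1) \<and>
     z_su s 1 = 0 \<and>
     (\<forall>t\<in>time_steps d. hydrogen s t \<le> production_bound d s t) \<and>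
     (\<forall>t\<in>time_steps d.
        P_min d * z_on s t \<le> power_on s t \<and> power_on s t \<le> P_max d * z_on s t) \<and>
     (\<forall>t\<in>time_steps d. power s t = power_on s t + P_sb d * z_sb s t)"

definition objective :: "'n hyp_soc_data \<Rightarrow> schedule \<Rightarrow> real" where
  "objective d s =
     (\<Sum>t\<in>time_steps d.
        sold s t * power_price d t + hydrogen s t * hydrogen_price d - z_su s t * startup_cost d)"

definition optimal :: "'n hyp_soc_data \<Rightarrow> schedule \<Rightarrow> bool" where
  "optimal d s \<longleftrightarrow> feasible d s \<and> (\<forall>s'. feasible d s' \<longrightarrow> objective d s' \<le> objective d s)"

definition relaxation_exact :: "'n hyp_soc_data \<Rightarrow> schedule \<Rightarrow> bool" where
  "relaxation_exact d s \<longleftrightarrow> (\<forall>t\<in>time_steps d. hydrogen s t = production_bound d s t)"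

end

theory Submission
  imports Defs
begin

text \<open>
  If the relaxation constraint were strict at a time step, the slack in it and in the demand
  constraint of its sub-period would allow slightly more hydrogen to be sold at that step, with all
  other decisions unchanged; as the hydrogen price is positive, this contradicts optimality.
\<close>

definition add_hydrogen :: "nat \<Rightarrow> real \<Rightarrow> schedule \<Rightarrow> schedule" where
  "add_hydrogen t e s = s\<lparr>hydrogen := (hydrogen s)(t := hydrogen s t + e)\<rparr>"

lemma add_hydrogen_simps [simp]:
  "sold (add_hydrogen t e s) = sold s"
  "power (add_hydrogen t e s) = power s"
  "hydrogen (add_hydrogen t e s) = (hydrogen s)(t := hydrogen s t + e)"
  "power_on (add_hydrogen t e s) = power_on s"
  "z_on (add_hydrogen t e s) = z_on s"
  "z_off (add_hydrogen t e s) = z_off s"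
  "z_sb (add_hydrogen t e s) = z_sb s"
  "z_su (add_hydrogen t e s) = z_su s"
  "production_bound d (add_hydrogen t e s) = production_bound d s"
  by (simp_all add: add_hydrogen_def production_bound_def fun_eq_iff)

lemma sum_fun_upd_add:
  fixes h :: "'a \<Rightarrow> 'b::comm_monoid_add"
  assumes "finite S"
  shows "sum (h(t := h t + e)) S = sum h S + (if t \<in> S then e else 0)"
proof -
  \<comment> \<open>Writing the update as the addition of a function supported at \<open>t\<close>
    lets the sum split.\<close>
  have "sum (h(t := h t + e)) S = (\<Sum>x\<in>S. h x + (if x = t then e else 0))"
    by (rule sum.cong) auto
  then show ?thesis
    using assms by (simp add: sum.distrib)
qed

lemma objective_add_hydrogen:
  assumes "t \<in> time_steps d"
  shows "objective d (add_hydrogen t e s) = objective d s + e * hydrogen_price d"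
proof -
  have "(\<Sum>i\<in>time_steps d. ((hydrogen s)(t := hydrogen s t + e)) i * hydrogen_price d)
      = (\<Sum>i\<in>time_steps d. hydrogen s i * hydrogen_price d) + e * hydrogen_price d"
    using assms sum_fun_upd_add[of "time_steps d" "hydrogen s" t e]
    by (simp add: distrib_right flip: sum_distrib_right)
  then show ?thesis
    by (simp add: objective_def sum.distrib sum_subtractf del: fun_upd_apply)
qed

text \<open>\<open>hydrogen\<close> enters only the sign, demand and relaxation constraints, and
  \<open>production_bound\<close> does not depend on it. All other constraints carry over
  unchanged.\<close>

lemma feasible_add_hydrogen:
  assumes "feasible d s" and "0 \<le> e"
    and "hydrogen s t + e \<le> production_bound d s t"
    and "\<And>n. n \<in> period_index d \<Longrightarrow>
      sum ((hydrogen s)(t := hydrogen s t + e)) (sub_period d n) \<le> demand_max d n"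
  shows "feasible d (add_hydrogen t e s)"
proof -
  have "\<forall>i\<in>time_steps d. 0 \<le> ((hydrogen s)(t := hydrogen s t + e)) i"
    using assms(1,2) by (auto simp: feasible_def)
  moreover have "\<forall>i\<in>time_steps d.
      ((hydrogen s)(t := hydrogen s t + e)) i \<le> production_bound d s i"
    using assms(1,3) by (auto simp: feasible_def)
  moreover have "\<forall>n\<in>period_index d.
      sum ((hydrogen s)(t := hydrogen s t + e)) (sub_period d n) \<le> demand_max d n"
    using assms(4) by blast
  \<comment> \<open>Distributing the bounded quantifiers over conjunctions isolates each constraint,
    so that every conjunct is either one of the three facts above or an assumption on
    \<open>s\<close>.\<close>
  ultimately show ?thesis
    using assms(1) unfolding feasible_def add_hydrogen_simps ball_conj_distrib
    by (elim conjE, intro conjI)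
qed

theorem theorem1:
  fixes d :: "'n hyp_soc_data" and s :: schedule
  assumes "valid_data d"
    and "optimal d s"
    and "\<forall>n\<in>period_index d. (\<Sum>t\<in>sub_period d n. hydrogen s t) < demand_max d n"
  shows "relaxation_exact d s"
  unfolding relaxation_exact_def
proof (rule ballI, rule ccontr)
  fix t
  assume t: "t \<in> time_steps d" and "hydrogen s t \<noteq> production_bound d s t"
  have feas: "feasible d s" and opt: "\<And>s'. feasible d s' \<Longrightarrow> objective d s' \<le> objective d s"
    using assms(2) by (auto simp: optimal_def)
  have slack: "hydrogen s t < production_bound d s t"
    using feas t \<open>hydrogen s t \<noteq> _\<close> unfolding feasible_def by (metis order_le_less)
  have cover: "(\<Union>n\<in>period_index d. sub_period d n) = time_steps d"
    and disj: "disjoint_family_on (sub_period d) (period_index d)"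
    and price: "hydrogen_price d > 0"
    using assms(1) by (auto simp: valid_data_def)
  obtain m where m: "m \<in> period_index d" "t \<in> sub_period d m"
    using cover t by blast
  \<comment> \<open>Since the sub-periods are disjoint, a change at \<open>t\<close> affects a
    single demand constraint, and \<open>e\<close> has to respect only that slack.\<close>
  have only_m: "n = m" if "n \<in> period_index d" "t \<in> sub_period d n" for n
    using disj that m unfolding disjoint_family_on_def by blast
  \<comment> \<open>The largest increase at \<open>t\<close> that both the relaxation constraint and
    the demand constraint of \<open>m\<close> allow.\<close>
  define e where "e = min (production_bound d s t - hydrogen s t)
    (demand_max d m - sum (hydrogen s) (sub_period d m))"
  have "e > 0"
    using slack assms(3) m(1) by (simp add: e_def)
  have "feasible d (add_hydrogen t e s)"
  proof (rule feasible_add_hydrogen[OF feas])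
    show "0 \<le> e" "hydrogen s t + e \<le> production_bound d s t"
      using \<open>e > 0\<close> by (auto simp: e_def)
    fix n
    assume n: "n \<in> period_index d"
    \<comment> \<open>Needed for \<open>sum_fun_upd_add\<close>, as \<open>sum\<close> over an
      infinite set is 0 by convention.\<close>
    have "finite (sub_period d n)"
      using cover n by (metis UN_upper finite_atLeastAtMost finite_subset)
    moreover have "e \<le> demand_max d m - sum (hydrogen s) (sub_period d m)"
      by (simp add: e_def)
    \<comment> \<open>If \<open>t\<close> lies in \<open>sub_period d n\<close>, then
      \<open>n = m\<close> and the bound on \<open>e\<close> applies; otherwise the sum is
      unchanged. Removing \<open>fun_upd_apply\<close> keeps the updated function intact for
      rewriting with \<open>sum_fun_upd_add\<close>.\<close>
    ultimately show "sum ((hydrogen s)(t := hydrogen s t + e)) (sub_period d n) \<le> demand_max d n"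
      using only_m[OF n] assms(3) n by (auto simp: sum_fun_upd_add less_imp_le simp del: fun_upd_apply)
  qed
  then have "e * hydrogen_price d \<le> 0"
    using opt[of "add_hydrogen t e s"] objective_add_hydrogen[OF t, of e s] by simp
  then show False
    using \<open>e > 0\<close> price by (simp add: mult_le_0_iff)
qed

end
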